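(* Let $A,B,C$ be projective cameras with distinct centers, and let $\pi$ be a correspondence of one of the types PLL, LLL, PPL, PLP, PPP for $(A,B,C)$. Assume $\pi$ avoids epipoles, i.e. every image point of $\pi$ in the view of camera $i$ is different from both epipoles in view $i$, and every image line of $\pi$ in view $i$ contains neither epipole in view $i$. If $\pi$ lies in the corresponding multi-view variety $X^{\ast}_{A,B,C}$, then $\pi$ is consistent with $(A,B,C)$.
   Context: A projective camera is a full-rank matrix in $\mathbb{C}^{3\times4}$ up to scalar with center its kernel in $\mathbb{P}^3$; $\alpha,\beta,\gamma$ denote the projections given by $A,B,C$. Epipoles: $e_{1\leftarrow2}=\alpha(\ker B)$, $e_{1\leftarrow3}=\alpha(\ker C)$ in view 1; $e_{2\leftarrow1}=\beta(\ker A)$, $e_{2\leftarrow3}=\beta(\ker C)$ in view 2; $e_{3\leftarrow1}=\gamma(\ker A)$, $e_{3\leftarrow2}=\gamma(\ker B)$ in view 3. Types: PLL $\in\mathbb{P}^2\times(\mathbb{P}^2)^\vee\times(\mathbb{P}^2)^\vee$, LLL $\in((\mathbb{P}^2)^\vee)^3$, PPL $\in\mathbb{P}^2\times\mathbb{P}^2\times(\mathbb{P}^2)^\vee$, PLP $\in\mathbb{P}^2\times(\mathbb{P}^2)^\vee\times\mathbb{P}^2$, PPP $\in(\mathbb{P}^2)^3$. With $\mathcal{F\ell}_{0,1}=\{(X,L): X\in L\}\subset\mathbb{P}^3\times\mathrm{Gr}(\mathbb{P}^1,\mathbb{P}^3)$, the multi-view variety of each type is the Zariski closure of the image of the rational map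 sending $(X,L)\in\mathcal{F\ell}_{0,1}$ (or $L$ for LLL, $X$ for PPP) to the triple whose $i$-th entry is the image of $X$ under camera $i$ if the $i$-th factor is a point and the image of $L$ if it is a line. $(A,B,C)$ is consistent with $\pi$ if there exist $X\in\mathbb{P}^3$ and a line $L\ni X$ such that each camera maps $X$ (resp. $L$) exactly to the given image point (resp. image line) in its factor, these images being defined. *)

theory Defs
  imports "HOL-Analysis.Analysis"
begin

text \<open>Homogeneous coordinates.  A point of P^n is represented by a nonzero vector
  of complex^(n+1); a line of P^2 (element of the dual plane) by a nonzero covector
  u in complex^3, the line being {v. bdot u v = 0}.  A line of P^3 is a
  2-dimensional (complex-linear) subspace of complex^4.\<close>

definition bdot :: "complex^3 \<Rightarrow> complex^3 \<Rightarrow> complex" where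
  "bdot u v = (\<Sum>i\<in>UNIV. u $ i * v $ i)"

definition projeq :: "'a::field^'n \<Rightarrow> 'a^'n \<Rightarrow> bool" where
  "projeq u v \<longleftrightarrow> u \<noteq> 0 \<and> v \<noteq> 0 \<and> (\<exists>c. c \<noteq> 0 \<and> u = c *s v)"

text \<open>Projective camera: full-rank 3x4 complex matrix.\<close>
definition camera :: "complex^4^3 \<Rightarrow> bool" where
  "camera A \<longleftrightarrow> rank A = 3"

text \<open>Center of a camera (as the kernel subspace; a single projective point).\<close>
definition center :: "complex^4^3 \<Rightarrow> (complex^4) set" where
  "center A = {v. A *v v = 0}"

text \<open>Lines of P^3 and the point-line flag variety.\<close>
definition is_line3 :: "(complex^4) set \<Rightarrow> bool" where
  "is_line3 L \<longleftrightarrow> vec.subspace L \<and> vec.dim L = 2"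

definition flag :: "complex^4 \<Rightarrow> (complex^4) set \<Rightarrow> bool" where
  "flag X L \<longleftrightarrow> X \<noteq> 0 \<and> is_line3 L \<and> X \<in> L"

datatype kind = Pt | Line

text \<open>The i-th factor u of a triple is the (defined) image of the flag (X,L)
  under camera A: the image of X if the factor is a point, the image of L if it
  is a line.\<close>
definition img_factor :: "kind \<Rightarrow> complex^4^3 \<Rightarrow> complex^4 \<Rightarrow> (complex^4) set \<Rightarrow> complex^3 \<Rightarrow> bool" where
  "img_factor k A X L u = (case k of
      Pt \<Rightarrow> A *v X \<noteq> 0 \<and> projeq u (A *v X)
    | Line \<Rightarrow> vec.dim ((\<lambda>v. A *v v) ` L) = 2 \<and> u \<noteq> 0 \<and>
            (\<lambda>v. A *v v) ` L = {w. bdot u w = 0})"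

text \<open>Consistency of a correspondence pi = (u1,u2,u3) of type (k1,k2,k3).\<close>
definition consistent ::
  "kind \<times> kind \<times> kind \<Rightarrow> complex^4^3 \<Rightarrow> complex^4^3 \<Rightarrow> complex^4^3 \<Rightarrow>
   (complex^3) \<times> (complex^3) \<times> (complex^3) \<Rightarrow> bool" where
  "consistent t A B C p \<longleftrightarrow>
     (case t of (k1, k2, k3) \<Rightarrow> case p of (u1, u2, u3) \<Rightarrow>
       (\<exists>X L. flag X L \<and> img_factor k1 A X L u1 \<and> img_factor k2 B X L u2 \<and>
              img_factor k3 C X L u3))"

text \<open>Image of the rational map (all homogeneous representatives, i.e. the affine
  multi-cone over the image in the product of projective planes).\<close>
definition mv_image ::
  "kind \<times> kind \<times> kind \<Rightarrow> complex^4^3 \<Rightarrow> complex^4^3 \<Rightarrow> complex^4^3 \<Rightarrow>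
   ((complex^3) \<times> (complex^3) \<times> (complex^3)) set" where
  "mv_image t A B C = {p. case t of (k1, k2, k3) \<Rightarrow> case p of (u1, u2, u3) \<Rightarrow>
       (\<exists>X L. flag X L \<and> img_factor k1 A X L u1 \<and> img_factor k2 B X L u2 \<and>
              img_factor k3 C X L u3)}"

text \<open>Polynomial functions in the 9 coordinates of complex^3 x complex^3 x complex^3.\<close>
inductive_set polyfun :: "(((complex^3) \<times> (complex^3) \<times> (complex^3)) \<Rightarrow> complex) set" where
  const: "(\<lambda>_. c) \<in> polyfun"
| coord1: "(\<lambda>(x, y, z). x $ i) \<in> polyfun"
| coord2: "(\<lambda>(x, y, z). y $ i) \<in> polyfun"
| coord3: "(\<lambda>(x, y, z). z $ i) \<in> polyfun"
| add: "f \<in> polyfun \<Longrightarrow> g \<in> polyfun \<Longrightarrow> (\<lambda>p. f p + g p) \<in> polyfun"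
| mult: "f \<in> polyfun \<Longrightarrow> g \<in> polyfun \<Longrightarrow> (\<lambda>p. f p * g p) \<in> polyfun"

definition zariski_closure ::
  "((complex^3) \<times> (complex^3) \<times> (complex^3)) set \<Rightarrow> ((complex^3) \<times> (complex^3) \<times> (complex^3)) set" where
  "zariski_closure S = {p. \<forall>f\<in>polyfun. (\<forall>s\<in>S. f s = 0) \<longrightarrow> f p = 0}"

text \<open>Multi-view variety, as the set of representatives (u1,u2,u3) with all ui nonzero
  of points of the Zariski closure of the image in (P^2 or dual P^2)^3.\<close>
definition multiview_variety ::
  "kind \<times> kind \<times> kind \<Rightarrow> complex^4^3 \<Rightarrow> complex^4^3 \<Rightarrow> complex^4^3 \<Rightarrow>
   ((complex^3) \<times> (complex^3) \<times> (complex^3)) set" where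
  "multiview_variety t A B C =
     {(u1, u2, u3). u1 \<noteq> 0 \<and> u2 \<noteq> 0 \<and> u3 \<noteq> 0} \<inter> zariski_closure (mv_image t A B C)"

text \<open>Factor u (of kind k) in the view of camera A avoids the epipole A(ker B).\<close>
definition avoids_epipole :: "kind \<Rightarrow> complex^4^3 \<Rightarrow> complex^4^3 \<Rightarrow> complex^3 \<Rightarrow> bool" where
  "avoids_epipole k A B u = (\<forall>c. c \<noteq> 0 \<and> B *v c = 0 \<longrightarrow>
      (case k of Pt \<Rightarrow> \<not> projeq u (A *v c) | Line \<Rightarrow> bdot u (A *v c) \<noteq> 0))"

definition avoids_epipoles ::
  "kind \<times> kind \<times> kind \<Rightarrow> complex^4^3 \<Rightarrow> complex^4^3 \<Rightarrow> complex^4^3 \<Rightarrow>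
   (complex^3) \<times> (complex^3) \<times> (complex^3) \<Rightarrow> bool" where
  "avoids_epipoles t A B C p \<longleftrightarrow>
     (case t of (k1, k2, k3) \<Rightarrow> case p of (u1, u2, u3) \<Rightarrow>
        avoids_epipole k1 A B u1 \<and> avoids_epipole k1 A C u1 \<and>
        avoids_epipole k2 B A u2 \<and> avoids_epipole k2 B C u2 \<and>
        avoids_epipole k3 C A u3 \<and> avoids_epipole k3 C B u3)"

end

theory Submission
  imports Defs
begin

text \<open>For the types with a point factor, membership of a triple p in the image says that a
  7-column matrix M(p), whose entries are polynomial in p, has a nontrivial kernel vector
  (X, m1, m2, m3): the equations are A X + m u = 0 for a point u and u \<bullet> (A X) = 0 for a
  line u.  Having a nontrivial kernel is a Zariski-closed condition (if M(p) were injective,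
  det (R M) for a left inverse R of M(p) would separate p from the image), so it persists on
  the closure.  There epipole avoidance and distinct centers force X \<noteq> 0 and every scale
  m \<noteq> 0, so X is a common preimage of the image points, and a line through X inside the
  back-projected planes of the image lines is found by counting dimensions in C^4.
  For three lines the three back-projected planes annihilate a common line of P^3, hence are
  linearly dependent; dependence is again closed.  Two of the planes meet in a line which then
  lies in the third, and epipole avoidance makes every camera map it onto the given line.\<close>

subsection \<open>Polynomial functions and the Zariski closure\<close>

lemma polyfun_sum:
  "finite S \<Longrightarrow> (\<And>i. i \<in> S \<Longrightarrow> f i \<in> polyfun) \<Longrightarrow> (\<lambda>p. \<Sum>i\<in>S. f i p) \<in> polyfun"
proof (induction S rule: finite_induct)
  case empty
  show ?case using polyfun.const[of 0] by simp
next
  case (insert x F)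
  then show ?case using polyfun.add[of "f x" "\<lambda>p. \<Sum>i\<in>F. f i p"] by simp
qed

lemma polyfun_prod:
  "finite S \<Longrightarrow> (\<And>i. i \<in> S \<Longrightarrow> f i \<in> polyfun) \<Longrightarrow> (\<lambda>p. \<Prod>i\<in>S. f i p) \<in> polyfun"
proof (induction S rule: finite_induct)
  case empty
  show ?case using polyfun.const[of 1] by simp
next
  case (insert x F)
  then show ?case using polyfun.mult[of "f x" "\<lambda>p. \<Prod>i\<in>F. f i p"] by simp
qed

lemma polyfun_const_mult: "f \<in> polyfun \<Longrightarrow> (\<lambda>p. c * f p) \<in> polyfun"
  using polyfun.mult[OF polyfun.const[of c]] by simp

lemma polyfun_if: "f \<in> polyfun \<Longrightarrow> g \<in> polyfun \<Longrightarrow> (\<lambda>p. if P then f p else g p) \<in> polyfun"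
  by (cases P) auto

lemma polyfun_fst: "(\<lambda>p. fst p $ i) \<in> polyfun"
  using polyfun.coord1[of i] unfolding case_prod_unfold by simp

lemma polyfun_fst_snd: "(\<lambda>p. fst (snd p) $ i) \<in> polyfun"
  using polyfun.coord2[of i] unfolding case_prod_unfold by simp

lemma polyfun_snd_snd: "(\<lambda>p. snd (snd p) $ i) \<in> polyfun"
  using polyfun.coord3[of i] unfolding case_prod_unfold by simp

lemma polyfun_vector_matrix_mult:
  assumes "\<And>i. (\<lambda>p. u p $ i) \<in> polyfun"
  shows "(\<lambda>p. (u p v* A) $ j) \<in> polyfun"
  unfolding vector_matrix_mult_def
  by (simp, intro polyfun_sum polyfun.mult polyfun.const assms) auto

lemma polyfun_det:
  fixes F :: "_ \<Rightarrow> complex^'n^'n"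
  assumes "\<And>i j. (\<lambda>p. F p $ i $ j) \<in> polyfun"
  shows "(\<lambda>p. det (F p)) \<in> polyfun"
  unfolding det_def by (intro polyfun_sum polyfun_prod polyfun_const_mult assms) auto

lemma polyfun_matrix_mult_left:
  fixes F :: "_ \<Rightarrow> complex^'n^'m" and R :: "complex^'m^'k"
  assumes "\<And>i j. (\<lambda>p. F p $ i $ j) \<in> polyfun"
  shows "(\<lambda>p. (R ** F p) $ i $ j) \<in> polyfun"
  unfolding matrix_matrix_mult_def
  by (simp, intro polyfun_sum polyfun_const_mult assms) auto

lemma zariski_closure_nontrivial_kernel:
  fixes F :: "_ \<Rightarrow> complex^'n^'m"
  assumes p: "p \<in> zariski_closure S"
    and singular: "\<And>s. s \<in> S \<Longrightarrow> \<exists>v. v \<noteq> 0 \<and> F s *v v = 0"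
    and poly: "\<And>i j. (\<lambda>s. F s $ i $ j) \<in> polyfun"
  shows "\<exists>v. v \<noteq> 0 \<and> F p *v v = 0"
proof (rule ccontr)
  assume "\<not> ?thesis"
  then obtain R where R: "R ** F p = mat 1"
    using matrix_left_invertible_ker by blast
  define f where "f s = det (R ** F s)" for s
  have "f \<in> polyfun"
    unfolding f_def by (intro polyfun_det polyfun_matrix_mult_left poly)
  moreover have "f s = 0" if s: "s \<in> S" for s
  proof -
    obtain v where v: "v \<noteq> 0" "F s *v v = 0" using singular[OF s] by blast
    then have "(R ** F s) *v v = 0" by (simp flip: matrix_vector_mul_assoc)
    then have "\<not> inj ((*v) (R ** F s))"
      using v(1) by (metis matrix_vector_mult_0_right injD)
    then show ?thesis
      unfolding f_def using det_nz_iff_inj_gen[of "(*v) (R ** F s)"] by simp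
  qed
  ultimately have "f p = 0" using p unfolding zariski_closure_def by blast
  then show False unfolding f_def R by simp
qed

subsection \<open>Linear algebra over a field\<close>

lemma dim_span_pair:
  fixes x y :: "'a::field^'n"
  assumes "x \<noteq> 0" "y \<notin> vec.span {x}"
  shows "vec.dim (vec.span {x, y}) = 2"
proof -
  have "x \<noteq> y" using assms vec.span_base by blast
  moreover have "vec.independent {y, x}"
    using assms by (intro vec.independent_insertI vec.independent_empty) (auto simp: vec.span_empty)
  ultimately show ?thesis
    using vec.dim_span_eq_card_independent[of "{y, x}"] by (simp add: insert_commute)
qed

lemma dim_hyperplane_less_card:
  fixes u :: "'a::field^'n"
  assumes "u \<noteq> 0"
  shows "vec.dim {w. (\<Sum>i\<in>UNIV. u $ i * w $ i) = 0} < CARD('n)"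
proof -
  let ?H = "{w. (\<Sum>i\<in>UNIV. u $ i * w $ i) = 0}"
  have "vec.subspace ?H"
    unfolding vec.subspace_def
    by (simp add: distrib_left sum.distrib flip: sum_distrib_left mult.left_commute)
  then have span_H: "vec.span ?H = ?H" by simp
  obtain k where k: "u $ k \<noteq> 0" using assms by (metis vec_eq_iff zero_index)
  have "(\<Sum>i\<in>UNIV. u $ i * axis k 1 $ i) = (\<Sum>i\<in>UNIV. if i = k then u $ i else 0)"
    by (intro sum.cong) (auto simp: axis_def)
  with k have "axis k 1 \<notin> vec.span ?H" by (simp add: span_H)
  then have "vec.span ?H \<subset> vec.span UNIV" by auto
  then have "vec.dim ?H < vec.dim (UNIV :: ('a^'n) set)" by (rule vec.dim_psubset)
  then show ?thesis by (simp add: vec_dim_card card_cart_basis)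
qed

lemma nontrivial_kernel_if_more_columns:
  fixes M :: "'a::field^'n^'m"
  assumes "CARD('m) < CARD('n)"
  shows "\<exists>x. x \<noteq> 0 \<and> M *v x = 0"
proof (rule ccontr)
  assume "\<not> ?thesis"
  then have "inj ((*v) M)" unfolding vec.inj_iff_eq_0 by blast
  then have "vec.dim (range ((*v) M)) = vec.dim (UNIV :: ('a^'n) set)"
    by (intro vec.dim_image_eq) (auto intro: inj_on_subset)
  moreover have "vec.dim (range ((*v) M)) \<le> CARD('m)" by (rule dim_subset_UNIV_cart_gen)
  ultimately show False using assms by (simp add: vec_dim_card card_cart_basis)
qed

text \<open>One extra equation (killing a coordinate where X is nonzero) keeps the kernel
  nontrivial and pushes it off the line through X.\<close>
lemma kernel_exists_not_in_span:
  fixes X :: "'a::field^'n" and Q :: "'a^'n^'m"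
  assumes "X \<noteq> 0" "CARD('m) + 1 < CARD('n)"
  shows "\<exists>Y. Y \<notin> vec.span {X} \<and> Q *v Y = 0"
proof -
  obtain i where i: "X $ i \<noteq> 0" using assms by (metis vec_eq_iff zero_index)
  define N :: "'a^'n^('m option)"
    where "N = (\<chi> r. case r of None \<Rightarrow> axis i 1 | Some k \<Rightarrow> Q $ k)"
  have "CARD('m option) < CARD('n)" using assms by (simp add: card_UNIV_option)
  then obtain Y where Y: "Y \<noteq> 0" "N *v Y = 0" using nontrivial_kernel_if_more_columns by blast
  have "(N *v Y) $ None = (\<Sum>j\<in>UNIV. axis i 1 $ j * Y $ j)"
    by (simp add: N_def matrix_vector_mult_def)
  also have "\<dots> = (\<Sum>j\<in>UNIV. if j = i then Y $ j else 0)"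
    by (intro sum.cong) (auto simp: axis_def)
  finally have Yi: "Y $ i = 0" using Y by simp
  have "(Q *v Y) $ k = (N *v Y) $ Some k" for k unfolding N_def matrix_vector_mult_def by simp
  then have "Q *v Y = 0" using Y by (simp add: vec_eq_iff)
  moreover have "Y \<notin> vec.span {X}"
  proof
    assume "Y \<in> vec.span {X}"
    then obtain c where "Y = c *s X" by (auto simp: vec.span_singleton)
    then show False using Yi i Y(1) by auto
  qed
  ultimately show ?thesis by blast
qed

lemma right_invertible_if_dim_rows:
  fixes A :: "'a::field^'n^'m"
  assumes "vec.dim (rows A) = CARD('m)"
  shows "\<exists>G. A ** G = mat 1"
  unfolding matrix_right_invertible_independent_rows
proof (intro allI impI ballI, rule ccontr)
  fix c k
  assume c: "(\<Sum>i\<in>UNIV. c i *s row i A) = 0" and ck: "c k \<noteq> 0"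
  let ?S = "(\<lambda>i. row i A) ` (UNIV - {k})"
  have "c k *s row k A = - (\<Sum>i\<in>UNIV - {k}. c i *s row i A)"
    using c by (simp add: sum.remove[of UNIV k] eq_neg_iff_add_eq_0)
  also have "\<dots> \<in> vec.span ?S"
    by (intro vec.span_neg vec.span_sum vec.span_scale vec.span_base) auto
  finally have "(1 / c k) *s (c k *s row k A) \<in> vec.span ?S" by (rule vec.span_scale)
  then have "row k A \<in> vec.span ?S" using ck by simp
  moreover have "rows A \<subseteq> insert (row k A) ?S" unfolding rows_def by auto
  ultimately have "rows A \<subseteq> vec.span ?S" using vec.span_superset by blast
  then have "vec.dim (rows A) \<le> card ?S" by (intro vec.dim_le_card) auto
  also have "\<dots> \<le> card (UNIV - {k})" by (rule card_image_le) auto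
  also have "\<dots> < CARD('m)" by (simp add: card_Diff_singleton)
  finally show False using assms by simp
qed

lemma dim_kernel_add_dim_rows_le:
  fixes N :: "'a::field^'n^'m"
  assumes "vec.dim (rows N) = CARD('m)"
  shows "vec.dim {v. N *v v = 0} + CARD('m) \<le> CARD('n)"
proof -
  obtain G where G: "N ** G = mat 1" using right_invertible_if_dim_rows[OF assms] by blast
  then have "inj ((*v) G)" using matrix_left_invertible_injective by blast
  then have dim_range: "vec.dim (range ((*v) G)) = CARD('m)"
    using vec.dim_image_eq[of "(*v) G" UNIV]
    by (simp add: vec_dim_card inj_on_subset card_cart_basis)
  have "range ((*v) G) \<inter> {v. N *v v = 0} = {0}"
  proof (intro equalityI subsetI)
    fix v assume "v \<in> range ((*v) G) \<inter> {v. N *v v = 0}"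
    then obtain w where "v = G *v w" "N *v v = 0" by auto
    moreover from this have "w = 0" by (metis G matrix_vector_mul_assoc matrix_vector_mul_lid)
    ultimately show "v \<in> {0}" by simp
  qed (auto intro!: rev_image_eqI[where x=0])
  then have dim_Int: "vec.dim (range ((*v) G) \<inter> {v. N *v v = 0}) = 0" by simp
  let ?sums = "{x + y |x y. x \<in> range ((*v) G) \<and> y \<in> {v. N *v v = 0}}"
  have "vec.dim ?sums + vec.dim (range ((*v) G) \<inter> {v. N *v v = 0})
      = vec.dim (range ((*v) G)) + vec.dim {v. N *v v = 0}"
    by (intro vec.dim_sums_Int vec.subspace_image vec.subspace_UNIV vec.subspace_kernel)
  moreover have "vec.dim ?sums \<le> CARD('n)" by (rule dim_subset_UNIV_cart_gen)
  ultimately show ?thesis using dim_range dim_Int by linarith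
qed

subsection \<open>Cameras and image factors\<close>

lemma camera_right_invertible: "camera A \<Longrightarrow> \<exists>G. A ** G = mat 1"
  unfolding camera_def row_rank_def_gen by (rule right_invertible_if_dim_rows) simp

lemma camera_kernel_in_span:
  assumes "camera A" "A *v X = 0" "X \<noteq> 0" "A *v Y = 0"
  shows "Y \<in> vec.span {X}"
proof (rule ccontr)
  assume "Y \<notin> vec.span {X}"
  then have "vec.dim (vec.span {X, Y}) = 2" using dim_span_pair[OF assms(3)] by simp
  moreover have "vec.span {X, Y} \<subseteq> {v. A *v v = 0}"
    using assms by (intro vec.span_minimal vec.subspace_kernel) auto
  then have "vec.dim (vec.span {X, Y}) \<le> vec.dim {v. A *v v = 0}" by (rule vec.dim_subset)
  moreover have "vec.dim {v. A *v v = 0} + 3 \<le> 4"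
    using dim_kernel_add_dim_rows_le[of A] assms(1) by (simp add: camera_def row_rank_def_gen)
  ultimately show False by simp
qed

lemma center_eq_if_common_kernel:
  assumes "camera A" "camera B" "A *v X = 0" "B *v X = 0" "X \<noteq> 0"
  shows "center A = center B"
proof -
  have "center M = vec.span {X}" if "camera M" "M *v X = 0" for M
  proof
    show "center M \<subseteq> vec.span {X}"
      unfolding center_def using camera_kernel_in_span[OF that assms(5)] by blast
    show "vec.span {X} \<subseteq> center M"
      unfolding center_def using that by (intro vec.span_minimal vec.subspace_kernel) auto
  qed
  then show ?thesis using assms by simp
qed

lemma bdot_vector_matrix_mult: "(\<Sum>j\<in>UNIV. (u v* A) $ j * v $ j) = bdot u (A *v v)"
  unfolding vector_matrix_mult_def bdot_def matrix_vector_mult_def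
  by (simp add: sum_distrib_left sum_distrib_right) (subst sum.swap, simp add: ac_simps)

lemma subspace_bdot_kernel: "vec.subspace {w. bdot u w = 0}"
  unfolding vec.subspace_def bdot_def
  by (simp add: distrib_left sum.distrib flip: sum_distrib_left mult.left_commute)

lemma img_factor_PtI:
  assumes "A *v X + m *s u = 0" "A *v X \<noteq> 0" "u \<noteq> 0"
  shows "img_factor Pt A X L u"
proof -
  have "m \<noteq> 0" using assms(1,2) by auto
  have "A *v X = (- m) *s u" using assms(1) by (simp add: eq_neg_iff_add_eq_0)
  then have "u = (- 1 / m) *s (A *v X)"
    using \<open>m \<noteq> 0\<close> by (simp add: vector_smult_assoc)
  then show ?thesis
    unfolding img_factor_def projeq_def using assms(2,3) \<open>m \<noteq> 0\<close> by (auto intro!: exI[of _ "- 1 / m"])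
qed
lemma img_factor_LineI:
  fixes A :: "complex^4^3"
  assumes u: "u \<noteq> 0" and on_line: "bdot u (A *v X) = 0" "bdot u (A *v Y) = 0"
    and independent: "A *v X \<noteq> 0" "A *v Y \<notin> vec.span {A *v X}"
  shows "img_factor Line A X (vec.span {X, Y}) u"
proof -
  let ?H = "{w. bdot u w = 0}"
  have image: "(\<lambda>v. A *v v) ` vec.span {X, Y} = vec.span {A *v X, A *v Y}"
    using vec.span_image[of A "{X, Y}"] by simp
  have dim: "vec.dim (vec.span {A *v X, A *v Y}) = 2"
    using dim_span_pair[OF independent] .
  have subspace_H: "vec.subspace ?H" by (rule subspace_bdot_kernel)
  have "vec.dim ?H < 3" using dim_hyperplane_less_card[OF u] by (simp add: bdot_def)
  moreover have "vec.span {A *v X, A *v Y} \<subseteq> ?H"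
    using on_line subspace_H by (intro vec.span_minimal) auto
  ultimately have "vec.span {A *v X, A *v Y} = ?H"
    using dim subspace_H by (intro vec.subspace_dim_equal) auto
  then show ?thesis unfolding img_factor_def using image dim u by simp
qed

lemma img_factor_Line_if_off_center:
  fixes A :: "complex^4^3"
  assumes X: "X \<noteq> 0" and Y: "Y \<notin> vec.span {X}" and u: "u \<noteq> 0"
    and in_plane: "\<And>v. v \<in> vec.span {X, Y} \<Longrightarrow> bdot u (A *v v) = 0"
    and off_center: "\<And>v. v \<in> vec.span {X, Y} \<Longrightarrow> v \<noteq> 0 \<Longrightarrow> A *v v \<noteq> 0"
  shows "img_factor Line A X (vec.span {X, Y}) u"
proof (rule img_factor_LineI[OF u])
  have XY: "X \<in> vec.span {X, Y}" "Y \<in> vec.span {X, Y}" by (auto intro: vec.span_base)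
  then show "bdot u (A *v X) = 0" "bdot u (A *v Y) = 0" using in_plane by auto
  show "A *v X \<noteq> 0" using off_center[OF XY(1) X] .
  show "A *v Y \<notin> vec.span {A *v X}"
  proof
    assume "A *v Y \<in> vec.span {A *v X}"
    then obtain c where c: "A *v Y = c *s (A *v X)" by (auto simp: vec.span_singleton)
    have "Y - c *s X \<in> vec.span {X, Y}" using XY by (intro vec.span_diff vec.span_scale)
    moreover have "Y - c *s X \<noteq> 0"
    proof
      assume "Y - c *s X = 0"
      then have "Y = c *s X" by simp
      then show False using Y by (auto simp: vec.span_singleton)
    qed
    moreover have "A *v (Y - c *s X) = 0" using c by (simp add: matrix_vector_mult_diff_distrib vec.scale)
    ultimately show False using off_center by blast
  qed
qed

lemma flag_span_pair:
  assumes "X \<noteq> 0" "Y \<notin> vec.span {X}"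
  shows "flag X (vec.span {X, Y})"
  unfolding flag_def is_line3_def using assms dim_span_pair[OF assms] by (auto intro: vec.span_base)

subsection \<open>The multi-view matrix of a correspondence with a point factor\<close>

text \<open>For a line factor the scale m is forced to be zero, so that all factor types share
  the column format 4 + 3 of the multi-view matrix below.\<close>
fun factor_eqn :: "kind \<Rightarrow> complex^4^3 \<Rightarrow> complex^3 \<Rightarrow> complex^4 \<Rightarrow> complex \<Rightarrow> bool" where
  "factor_eqn Pt A u X m \<longleftrightarrow> A *v X + m *s u = 0"
| "factor_eqn Line A u X m \<longleftrightarrow> bdot u (A *v X) = 0 \<and> m = 0"

text \<open>The three rows contributed by a factor whose scale sits in column Inr e.\<close>
definition eqn_block :: "kind \<Rightarrow> complex^4^3 \<Rightarrow> complex^3 \<Rightarrow> 3 \<Rightarrow> 3 \<Rightarrow> 4 + 3 \<Rightarrow> complex" where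
  "eqn_block k A u e i c = (case k of
      Pt \<Rightarrow> (case c of Inl j \<Rightarrow> A $ i $ j | Inr m \<Rightarrow> if m = e then u $ i else 0)
    | Line \<Rightarrow> (if i = 1 then (case c of Inl j \<Rightarrow> (u v* A) $ j | Inr m \<Rightarrow> 0)
               else if i = 2 then (case c of Inl j \<Rightarrow> 0 | Inr m \<Rightarrow> if m = e then 1 else 0)
               else 0))"

definition multiview_matrix :: "kind \<times> kind \<times> kind \<Rightarrow> complex^4^3 \<Rightarrow> complex^4^3 \<Rightarrow> complex^4^3 \<Rightarrow>
   (complex^3) \<times> (complex^3) \<times> (complex^3) \<Rightarrow> complex^(4 + 3)^(3 + (3 + 3))" where
  "multiview_matrix t A B C p = (\<chi> r c. case r of
      Inl i \<Rightarrow> eqn_block (fst t) A (fst p) 1 i c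
    | Inr (Inl i) \<Rightarrow> eqn_block (fst (snd t)) B (fst (snd p)) 2 i c
    | Inr (Inr i) \<Rightarrow> eqn_block (snd (snd t)) C (snd (snd p)) 3 i c)"

definition point_part :: "complex^(4 + 3) \<Rightarrow> complex^4" where
  "point_part v = (\<chi> j. v $ Inl j)"

lemma sum_UNIV_Plus:
  "sum f (UNIV :: ('a::finite + 'b::finite) set) = (\<Sum>x\<in>UNIV. f (Inl x)) + (\<Sum>x\<in>UNIV. f (Inr x))"
  using sum.Plus[of "UNIV :: 'a set" "UNIV :: 'b set" f] by (simp add: UNIV_Plus_UNIV comp_def)

lemma sum_delta_mult:
  fixes f :: "'b::finite \<Rightarrow> 'a::semiring_0"
  shows "(\<Sum>m\<in>UNIV. (if m = e then a else 0) * f m) = a * f e"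
proof -
  have "(\<Sum>m\<in>UNIV. (if m = e then a else 0) * f m) = (\<Sum>m\<in>UNIV. if m = e then a * f m else 0)"
    by (intro sum.cong) auto
  then show ?thesis by simp
qed

lemma eqn_block_kernel_iff:
  "(\<forall>i. (\<Sum>c\<in>UNIV. eqn_block k A u e i c * v $ c) = 0) \<longleftrightarrow> factor_eqn k A u (point_part v) (v $ Inr e)"
proof (cases k)
  case Pt
  then have "(\<Sum>c\<in>UNIV. eqn_block k A u e i c * v $ c) = (A *v point_part v + (v $ Inr e) *s u) $ i" for i
    by (simp add: eqn_block_def sum_UNIV_Plus sum_delta_mult matrix_vector_mult_def point_part_def)
  then show ?thesis using Pt by (simp add: vec_eq_iff)
next
  case Line
  have "(\<Sum>c\<in>UNIV. eqn_block k A u e 1 c * v $ c) = bdot u (A *v point_part v)"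
    using Line bdot_vector_matrix_mult[of u A "point_part v"]
    by (simp add: eqn_block_def sum_UNIV_Plus point_part_def)
  moreover have "(\<Sum>c\<in>UNIV. eqn_block k A u e 2 c * v $ c) = v $ Inr e"
    using Line by (simp add: eqn_block_def sum_UNIV_Plus sum_delta_mult)
  moreover have "(\<Sum>c\<in>UNIV. eqn_block k A u e 3 c * v $ c) = 0"
    using Line by (simp add: eqn_block_def)
  ultimately show ?thesis using Line by (auto simp: forall_3)
qed

lemma multiview_matrix_kernel_iff:
  "multiview_matrix t A B C p *v v = 0 \<longleftrightarrow>
     factor_eqn (fst t) A (fst p) (point_part v) (v $ Inr 1) \<and>
     factor_eqn (fst (snd t)) B (fst (snd p)) (point_part v) (v $ Inr 2) \<and>
     factor_eqn (snd (snd t)) C (snd (snd p)) (point_part v) (v $ Inr 3)"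
  unfolding vec_eq_iff split_sum_all eqn_block_kernel_iff[symmetric]
  by (simp add: multiview_matrix_def matrix_vector_mult_def)

lemma polyfun_eqn_block:
  assumes "\<And>i. (\<lambda>p. u p $ i) \<in> polyfun"
  shows "(\<lambda>p. eqn_block k A (u p) e i c) \<in> polyfun"
  by (cases k; cases c)
    (simp_all add: eqn_block_def polyfun_if polyfun.const assms polyfun_vector_matrix_mult)

lemma polyfun_multiview_matrix: "(\<lambda>p. multiview_matrix t A B C p $ r $ c) \<in> polyfun"
proof (cases r)
  case (Inl i)
  then show ?thesis by (simp add: multiview_matrix_def polyfun_eqn_block polyfun_fst)
next
  case (Inr r')
  then show ?thesis
    by (cases r') (simp_all add: multiview_matrix_def polyfun_eqn_block polyfun_fst_snd polyfun_snd_snd)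
qed

lemma factor_eqn_if_img_factor:
  assumes "flag X L" "img_factor k A X L u"
  shows "\<exists>m. factor_eqn k A u X m"
proof (cases k)
  case Pt
  then obtain c where c: "c \<noteq> 0" "u = c *s (A *v X)"
    using assms(2) by (auto simp: img_factor_def projeq_def)
  then have "factor_eqn Pt A u X (- 1 / c)" by (simp add: vector_smult_assoc)
  then show ?thesis using Pt by blast
next
  case Line
  then show ?thesis using assms by (auto simp: flag_def img_factor_def)
qed

lemma multiview_matrix_singular_on_image:
  assumes "s \<in> mv_image t A B C"
  shows "\<exists>v. v \<noteq> 0 \<and> multiview_matrix t A B C s *v v = 0"
proof -
  obtain k1 k2 k3 where t: "t = (k1, k2, k3)" by (cases t)
  obtain w1 w2 w3 where s: "s = (w1, w2, w3)" by (cases s)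
  obtain X L where XL: "flag X L"
    "img_factor k1 A X L w1" "img_factor k2 B X L w2" "img_factor k3 C X L w3"
    using assms by (auto simp: mv_image_def t s)
  then obtain m1 m2 m3 where m: "factor_eqn k1 A w1 X m1" "factor_eqn k2 B w2 X m2" "factor_eqn k3 C w3 X m3"
    using factor_eqn_if_img_factor by metis
  define v :: "complex^(4 + 3)" where
    "v = (\<chi> c. case c of Inl j \<Rightarrow> X $ j | Inr e \<Rightarrow> if e = 1 then m1 else if e = 2 then m2 else m3)"
  have "point_part v = X" by (simp add: point_part_def v_def vec_eq_iff)
  then have "v \<noteq> 0" using XL(1) by (auto simp: flag_def point_part_def zero_vec_def)
  moreover have "multiview_matrix t A B C s *v v = 0"
    unfolding multiview_matrix_kernel_iff using m \<open>point_part v = X\<close> by (simp add: t s v_def)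
  ultimately show ?thesis by blast
qed

lemma factor_eqn_zero: "factor_eqn k A u 0 m \<Longrightarrow> u \<noteq> 0 \<Longrightarrow> m = 0"
  by (cases k) auto

lemma factor_eqns_of_closure:
  assumes "(u1, u2, u3) \<in> zariski_closure (mv_image (k1, k2, k3) A B C)"
    and u: "u1 \<noteq> 0" "u2 \<noteq> 0" "u3 \<noteq> 0"
  obtains X m1 m2 m3 where "X \<noteq> 0"
    "factor_eqn k1 A u1 X m1" "factor_eqn k2 B u2 X m2" "factor_eqn k3 C u3 X m3"
proof -
  obtain v where "v \<noteq> 0" and "multiview_matrix (k1, k2, k3) A B C (u1, u2, u3) *v v = 0"
    using zariski_closure_nontrivial_kernel[OF assms(1) multiview_matrix_singular_on_image
        polyfun_multiview_matrix] by blast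
  then have eqns: "factor_eqn k1 A u1 (point_part v) (v $ Inr 1)"
    "factor_eqn k2 B u2 (point_part v) (v $ Inr 2)" "factor_eqn k3 C u3 (point_part v) (v $ Inr 3)"
    by (simp_all add: multiview_matrix_kernel_iff)
  have "point_part v \<noteq> 0"
  proof
    assume X0: "point_part v = 0"
    then have "v $ Inr e = 0" for e
      using factor_eqn_zero eqns u exhaust_3[of e] by metis
    moreover have "v $ Inl j = 0" for j
      using X0 by (simp add: point_part_def vec_eq_iff)
    ultimately show False using \<open>v \<noteq> 0\<close> by (simp add: vec_eq_iff split_sum_all)
  qed
  with eqns show ?thesis using that by blast
qed

subsection \<open>Three image lines: dependence of the back-projected planes\<close>

text \<open>Its columns are the back-projected planes u v* A of the three image lines.\<close>
definition backproj_matrix :: "complex^4^3 \<Rightarrow> complex^4^3 \<Rightarrow> complex^4^3 \<Rightarrow>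
   (complex^3) \<times> (complex^3) \<times> (complex^3) \<Rightarrow> complex^3^4" where
  "backproj_matrix A B C p = (\<chi> j k. (if k = 1 then fst p v* A
      else if k = 2 then fst (snd p) v* B else snd (snd p) v* C) $ j)"

lemma polyfun_backproj_matrix: "(\<lambda>p. backproj_matrix A B C p $ j $ k) \<in> polyfun"
  by (cases "k = 1"; cases "k = 2")
    (simp_all add: backproj_matrix_def polyfun_vector_matrix_mult polyfun_fst polyfun_fst_snd
      polyfun_snd_snd)

lemma dim_annihilator_line_le:
  assumes "is_line3 L"
  shows "vec.dim {v. \<forall>x\<in>L. (\<Sum>j\<in>UNIV. v $ j * x $ j) = 0} \<le> 2"
proof -
  obtain B where B: "B \<subseteq> L" "vec.independent B" "card B = 2"
    using vec.basis_exists[of L] assms unfolding is_line3_def by metis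
  then obtain a b where ab: "B = {a, b}" by (meson card_2_iff)
  define N :: "complex^4^2" where "N = (\<chi> i. if i = 1 then a else b)"
  have "row 1 N = a" "row 2 N = b" by (simp_all add: N_def row_def)
  then have "rows N = B" unfolding rows_def ab using exhaust_2 by (auto; metis)
  then have "vec.dim (rows N) = 2" using B by (simp add: vec.dim_eq_card_independent)
  then have "vec.dim {v. N *v v = 0} \<le> 2" using dim_kernel_add_dim_rows_le[of N] by simp
  moreover have "{v. \<forall>x\<in>L. (\<Sum>j\<in>UNIV. v $ j * x $ j) = 0} \<subseteq> {v. N *v v = 0}"
    using B(1) by (auto simp: ab N_def vec_eq_iff forall_2 matrix_vector_mult_def mult.commute)
  ultimately show ?thesis using vec.dim_subset order_trans by blast
qed

text \<open>All three back-projected planes contain the line L, so they lie in its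
  two-dimensional annihilator.\<close>
lemma backproj_matrix_singular_on_image:
  assumes "s \<in> mv_image (Line, Line, Line) A B C"
  shows "\<exists>c. c \<noteq> 0 \<and> backproj_matrix A B C s *v c = 0"
proof (rule ccontr)
  let ?M = "backproj_matrix A B C s"
  obtain w1 w2 w3 where s: "s = (w1, w2, w3)" by (cases s)
  obtain X L where XL: "flag X L"
    "img_factor Line A X L w1" "img_factor Line B X L w2" "img_factor Line C X L w3"
    using assms by (auto simp: mv_image_def s)
  let ?Ann = "{v. \<forall>x\<in>L. (\<Sum>j\<in>UNIV. v $ j * x $ j) = 0}"
  have in_Ann: "w v* A' \<in> ?Ann" if "img_factor Line A' X L w" for A' w
    using that by (auto simp: img_factor_def bdot_vector_matrix_mult)
  have "column k ?M = (if k = 1 then w1 v* A else if k = 2 then w2 v* B else w3 v* C)" for k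
    by (simp add: column_def backproj_matrix_def s vec_eq_iff)
  then have "columns ?M \<subseteq> ?Ann"
    unfolding columns_def using in_Ann XL(2-4) by auto
  then have "range ((*v) ?M) \<subseteq> vec.span ?Ann"
    using matrix_vector_mult_in_columnspace_gen vec.span_mono by blast
  then have "vec.dim (range ((*v) ?M)) \<le> vec.dim (vec.span ?Ann)" by (rule vec.dim_subset)
  also have "\<dots> \<le> 2" using dim_annihilator_line_le XL(1) by (simp add: flag_def vec.dim_span)
  moreover assume "\<not> ?thesis"
  then have "inj ((*v) ?M)" unfolding vec.inj_iff_eq_0 by blast
  then have "vec.dim (range ((*v) ?M)) = 3"
    using vec.dim_image_eq[of "(*v) ?M" UNIV] by (simp add: vec_dim_card inj_on_subset card_cart_basis)
  ultimately show False by simp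
qed

lemma backproj_dependent_of_closure:
  assumes "(u1, u2, u3) \<in> zariski_closure (mv_image (Line, Line, Line) A B C)"
  obtains c1 c2 c3 where "c1 \<noteq> 0 \<or> c2 \<noteq> 0 \<or> c3 \<noteq> 0"
    "\<And>x. c1 * bdot u1 (A *v x) + c2 * bdot u2 (B *v x) + c3 * bdot u3 (C *v x) = 0"
proof -
  obtain c where c: "c \<noteq> 0" "backproj_matrix A B C (u1, u2, u3) *v c = 0"
    using zariski_closure_nontrivial_kernel[OF assms backproj_matrix_singular_on_image
        polyfun_backproj_matrix] by blast
  have "c $ 1 * bdot u1 (A *v x) + c $ 2 * bdot u2 (B *v x) + c $ 3 * bdot u3 (C *v x) = 0" for x
  proof -
    have "0 = (\<Sum>j\<in>UNIV. (backproj_matrix A B C (u1, u2, u3) *v c) $ j * x $ j)" using c(2) by simp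
    also have "\<dots> = (\<Sum>j\<in>UNIV. (c $ 1 * (u1 v* A) $ j + c $ 2 * (u2 v* B) $ j + c $ 3 * (u3 v* C) $ j) * x $ j)"
      by (simp add: matrix_vector_mult_def backproj_matrix_def sum_3 mult.commute)
    also have "\<dots> = c $ 1 * (\<Sum>j\<in>UNIV. (u1 v* A) $ j * x $ j) + c $ 2 * (\<Sum>j\<in>UNIV. (u2 v* B) $ j * x $ j)
        + c $ 3 * (\<Sum>j\<in>UNIV. (u3 v* C) $ j * x $ j)"
      by (simp add: sum_distrib_left sum.distrib algebra_simps)
    finally show ?thesis by (simp add: bdot_vector_matrix_mult)
  qed
  moreover have "c $ 1 \<noteq> 0 \<or> c $ 2 \<noteq> 0 \<or> c $ 3 \<noteq> 0" using c(1) by (auto simp: vec_eq_iff forall_3)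
  ultimately show ?thesis using that by blast
qed

subsection \<open>Constructing the flag\<close>

lemma off_center_of_line_eqn:
  assumes "avoids_epipole Line B A u" "bdot u (B *v X) = 0" "X \<noteq> 0"
  shows "A *v X \<noteq> 0"
  using assms by (auto simp: avoids_epipole_def)

lemma off_center_of_point_eqn:
  assumes "camera A" "camera B" "center A \<noteq> center B" "X \<noteq> 0"
    and "B *v X + m *s u = 0" "u \<noteq> 0" "avoids_epipole Pt B A u"
  shows "A *v X \<noteq> 0"
proof
  assume AX: "A *v X = 0"
  show False
  proof (cases "B *v X = 0")
    case True
    then show False using center_eq_if_common_kernel[OF assms(1,2) AX] assms(3,4) by blast
  next
    case False
    then have "projeq u (B *v X)"
      using img_factor_PtI[OF assms(5) False assms(6)] by (simp add: img_factor_def)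
    then show False using AX assms(4,7) by (auto simp: avoids_epipole_def)
  qed
qed

definition plane_pair :: "complex^4^3 \<Rightarrow> complex^3 \<Rightarrow> complex^4^3 \<Rightarrow> complex^3 \<Rightarrow> complex^4^2" where
  "plane_pair A u B w = (\<chi> i. if i = 1 then u v* A else w v* B)"

lemma plane_pair_kernel_iff:
  "plane_pair A u B w *v v = 0 \<longleftrightarrow> bdot u (A *v v) = 0 \<and> bdot w (B *v v) = 0"
  by (simp add: vec_eq_iff forall_2 plane_pair_def matrix_vector_mult_def bdot_vector_matrix_mult)

lemma point_in_two_planes:
  fixes A B :: "complex^4^3"
  obtains X where "X \<noteq> 0" "bdot u (A *v X) = 0" "bdot w (B *v X) = 0"
  using nontrivial_kernel_if_more_columns[of "plane_pair A u B w"] plane_pair_kernel_iff by auto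

lemma line_in_two_planes:
  fixes A B :: "complex^4^3"
  assumes "X \<noteq> 0" "bdot u (A *v X) = 0" "bdot w (B *v X) = 0"
  obtains Y where "Y \<notin> vec.span {X}"
    "\<And>v. v \<in> vec.span {X, Y} \<Longrightarrow> bdot u (A *v v) = 0 \<and> bdot w (B *v v) = 0"
proof -
  obtain Y where Y: "Y \<notin> vec.span {X}" "plane_pair A u B w *v Y = 0"
    using kernel_exists_not_in_span[OF assms(1), of "plane_pair A u B w"] by auto
  have "vec.span {X, Y} \<subseteq> {v. plane_pair A u B w *v v = 0}"
    using assms Y(2) plane_pair_kernel_iff by (intro vec.span_minimal vec.subspace_kernel) auto
  then show ?thesis using that Y(1) plane_pair_kernel_iff by blast
qed

lemma flag_LLL:
  fixes A1 A2 A3 :: "complex^4^3"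
  assumes u: "u1 \<noteq> 0" "u2 \<noteq> 0" "u3 \<noteq> 0" and "c3 \<noteq> 0"
    and dependent: "\<And>x. c1 * bdot u1 (A1 *v x) + c2 * bdot u2 (A2 *v x) + c3 * bdot u3 (A3 *v x) = 0"
    and avoid: "avoids_epipole Line A2 A1 u2" "avoids_epipole Line A1 A2 u1"
      "avoids_epipole Line A1 A3 u1"
  shows "\<exists>X L. flag X L \<and> img_factor Line A1 X L u1 \<and> img_factor Line A2 X L u2 \<and>
    img_factor Line A3 X L u3"
proof -
  obtain X where X: "X \<noteq> 0" "bdot u1 (A1 *v X) = 0" "bdot u2 (A2 *v X) = 0"
    using point_in_two_planes by blast
  obtain Y where Y: "Y \<notin> vec.span {X}"
    and planes: "\<And>v. v \<in> vec.span {X, Y} \<Longrightarrow> bdot u1 (A1 *v v) = 0 \<and> bdot u2 (A2 *v v) = 0"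
    using line_in_two_planes[OF X] by blast
  have plane3: "bdot u3 (A3 *v v) = 0" if "v \<in> vec.span {X, Y}" for v
    using dependent[of v] planes[OF that] \<open>c3 \<noteq> 0\<close> by simp
  have "img_factor Line A1 X (vec.span {X, Y}) u1"
    using img_factor_Line_if_off_center[OF X(1) Y u(1)] planes off_center_of_line_eqn[OF avoid(1)]
    by blast
  moreover have "img_factor Line A2 X (vec.span {X, Y}) u2"
    using img_factor_Line_if_off_center[OF X(1) Y u(2)] planes off_center_of_line_eqn[OF avoid(2)]
    by blast
  moreover have "img_factor Line A3 X (vec.span {X, Y}) u3"
    using img_factor_Line_if_off_center[OF X(1) Y u(3)] plane3 planes off_center_of_line_eqn[OF avoid(3)]
    by blast
  ultimately show ?thesis using flag_span_pair[OF X(1) Y] by blast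
qed

lemma flag_PLL:
  fixes A1 A2 A3 :: "complex^4^3"
  assumes u: "u1 \<noteq> 0" "u2 \<noteq> 0" "u3 \<noteq> 0" and X: "X \<noteq> 0"
    and eqns: "A1 *v X + m *s u1 = 0" "bdot u2 (A2 *v X) = 0" "bdot u3 (A3 *v X) = 0"
    and avoid: "avoids_epipole Line A2 A1 u2" "avoids_epipole Line A3 A2 u3"
      "avoids_epipole Line A2 A3 u2"
  shows "\<exists>X L. flag X L \<and> img_factor Pt A1 X L u1 \<and> img_factor Line A2 X L u2 \<and>
    img_factor Line A3 X L u3"
proof -
  obtain Y where Y: "Y \<notin> vec.span {X}"
    and planes: "\<And>v. v \<in> vec.span {X, Y} \<Longrightarrow> bdot u2 (A2 *v v) = 0 \<and> bdot u3 (A3 *v v) = 0"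
    using line_in_two_planes[OF X eqns(2,3)] by blast
  have "img_factor Pt A1 X (vec.span {X, Y}) u1"
    using img_factor_PtI[OF eqns(1) off_center_of_line_eqn[OF avoid(1) eqns(2) X] u(1)] .
  moreover have "img_factor Line A2 X (vec.span {X, Y}) u2"
    using img_factor_Line_if_off_center[OF X Y u(2)] planes off_center_of_line_eqn[OF avoid(2)]
    by blast
  moreover have "img_factor Line A3 X (vec.span {X, Y}) u3"
    using img_factor_Line_if_off_center[OF X Y u(3)] planes off_center_of_line_eqn[OF avoid(3)]
    by blast
  ultimately show ?thesis using flag_span_pair[OF X Y] by blast
qed

text \<open>The line is spanned by X and a preimage under A3 of a second point of the image line u3.\<close>
lemma flag_PPL:
  fixes A1 A2 A3 :: "complex^4^3"
  assumes cameras: "camera A1" "camera A2" "camera A3" and centers: "center A1 \<noteq> center A2"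
    and u: "u1 \<noteq> 0" "u2 \<noteq> 0" "u3 \<noteq> 0" and X: "X \<noteq> 0"
    and eqns: "A1 *v X + m1 *s u1 = 0" "A2 *v X + m2 *s u2 = 0" "bdot u3 (A3 *v X) = 0"
    and avoid: "avoids_epipole Pt A2 A1 u2" "avoids_epipole Pt A1 A2 u1"
      "avoids_epipole Pt A1 A3 u1"
  shows "\<exists>X L. flag X L \<and> img_factor Pt A1 X L u1 \<and> img_factor Pt A2 X L u2 \<and>
    img_factor Line A3 X L u3"
proof -
  have A1X: "A1 *v X \<noteq> 0"
    using off_center_of_point_eqn[OF cameras(1,2) centers X eqns(2) u(2) avoid(1)] .
  have "A2 *v X \<noteq> 0"
    using off_center_of_point_eqn[OF cameras(2,1) centers[symmetric] X eqns(1) u(1) avoid(2)] .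
  have A3X: "A3 *v X \<noteq> 0"
  proof
    assume "A3 *v X = 0"
    moreover have "projeq u1 (A1 *v X)"
      using img_factor_PtI[OF eqns(1) A1X u(1)] by (simp add: img_factor_def)
    ultimately show False using avoid(3) X by (auto simp: avoids_epipole_def)
  qed
  obtain w where w: "w \<notin> vec.span {A3 *v X}" "(\<chi> i::1. u3) *v w = 0"
    using kernel_exists_not_in_span[OF A3X, of "\<chi> i::1. u3"] by auto
  then have "bdot u3 w = 0" by (simp add: vec_eq_iff matrix_vector_mult_def bdot_def)
  obtain G where "A3 ** G = mat 1" using camera_right_invertible[OF cameras(3)] by blast
  then have A3Y: "A3 *v (G *v w) = w" by (metis matrix_vector_mul_assoc matrix_vector_mul_lid)
  have Y: "G *v w \<notin> vec.span {X}"
  proof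
    assume "G *v w \<in> vec.span {X}"
    then obtain c where "G *v w = c *s X" by (auto simp: vec.span_singleton)
    then have "w = c *s (A3 *v X)" using A3Y by (simp add: vec.scale)
    then show False using w(1) by (auto simp: vec.span_singleton)
  qed
  have "img_factor Line A3 X (vec.span {X, G *v w}) u3"
    using img_factor_LineI[OF u(3) eqns(3)] A3Y \<open>bdot u3 w = 0\<close> w(1) A3X by simp
  moreover have "img_factor Pt A1 X L u1" "img_factor Pt A2 X L u2" for L
    using img_factor_PtI eqns u A1X \<open>A2 *v X \<noteq> 0\<close> by blast+
  ultimately show ?thesis using flag_span_pair[OF X Y] by blast
qed

lemma flag_PPP:
  fixes A1 A2 A3 :: "complex^4^3"
  assumes cameras: "camera A1" "camera A2" "camera A3"
    and centers: "center A1 \<noteq> center A2" "center A1 \<noteq> center A3"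
    and u: "u1 \<noteq> 0" "u2 \<noteq> 0" "u3 \<noteq> 0" and X: "X \<noteq> 0"
    and eqns: "A1 *v X + m1 *s u1 = 0" "A2 *v X + m2 *s u2 = 0" "A3 *v X + m3 *s u3 = 0"
    and avoid: "avoids_epipole Pt A2 A1 u2" "avoids_epipole Pt A1 A2 u1"
      "avoids_epipole Pt A1 A3 u1"
  shows "\<exists>X L. flag X L \<and> img_factor Pt A1 X L u1 \<and> img_factor Pt A2 X L u2 \<and>
    img_factor Pt A3 X L u3"
proof -
  have "A1 *v X \<noteq> 0"
    using off_center_of_point_eqn[OF cameras(1,2) centers(1) X eqns(2) u(2) avoid(1)] .
  moreover have "A2 *v X \<noteq> 0"
    using off_center_of_point_eqn[OF cameras(2,1) centers(1)[symmetric] X eqns(1) u(1) avoid(2)] .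
  moreover have "A3 *v X \<noteq> 0"
    using off_center_of_point_eqn[OF cameras(3,1) centers(2)[symmetric] X eqns(1) u(1) avoid(3)] .
  ultimately have "img_factor Pt A1 X L u1" "img_factor Pt A2 X L u2" "img_factor Pt A3 X L u3" for L
    using img_factor_PtI eqns u by blast+
  moreover obtain Y where "Y \<notin> vec.span {X}"
    using kernel_exists_not_in_span[OF X, of "0 :: complex^4^1"] by auto
  ultimately show ?thesis using flag_span_pair[OF X] by blast
qed

lemma consistent_PLL:
  assumes u: "u1 \<noteq> 0" "u2 \<noteq> 0" "u3 \<noteq> 0"
    and avoid: "avoids_epipoles (Pt, Line, Line) A B C (u1, u2, u3)"
    and closure: "(u1, u2, u3) \<in> zariski_closure (mv_image (Pt, Line, Line) A B C)"
  shows "consistent (Pt, Line, Line) A B C (u1, u2, u3)"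
proof -
  obtain X m1 m2 m3 where "X \<noteq> 0"
    "factor_eqn Pt A u1 X m1" "factor_eqn Line B u2 X m2" "factor_eqn Line C u3 X m3"
    using factor_eqns_of_closure[OF closure u] .
  then show ?thesis
    using flag_PLL[OF u] avoid by (simp add: consistent_def avoids_epipoles_def)
qed

lemma consistent_PPL:
  assumes "camera A" "camera B" "camera C" "center A \<noteq> center B"
    and u: "u1 \<noteq> 0" "u2 \<noteq> 0" "u3 \<noteq> 0"
    and avoid: "avoids_epipoles (Pt, Pt, Line) A B C (u1, u2, u3)"
    and closure: "(u1, u2, u3) \<in> zariski_closure (mv_image (Pt, Pt, Line) A B C)"
  shows "consistent (Pt, Pt, Line) A B C (u1, u2, u3)"
proof -
  obtain X m1 m2 m3 where "X \<noteq> 0"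
    "factor_eqn Pt A u1 X m1" "factor_eqn Pt B u2 X m2" "factor_eqn Line C u3 X m3"
    using factor_eqns_of_closure[OF closure u] .
  then show ?thesis
    using flag_PPL[OF assms(1-4) u] avoid by (simp add: consistent_def avoids_epipoles_def)
qed

lemma consistent_PLP:
  assumes "camera A" "camera B" "camera C" "center A \<noteq> center C"
    and u: "u1 \<noteq> 0" "u2 \<noteq> 0" "u3 \<noteq> 0"
    and avoid: "avoids_epipoles (Pt, Line, Pt) A B C (u1, u2, u3)"
    and closure: "(u1, u2, u3) \<in> zariski_closure (mv_image (Pt, Line, Pt) A B C)"
  shows "consistent (Pt, Line, Pt) A B C (u1, u2, u3)"
proof -
  obtain X m1 m2 m3 where X: "X \<noteq> 0" and
    eqns: "factor_eqn Pt A u1 X m1" "factor_eqn Line B u2 X m2" "factor_eqn Pt C u3 X m3"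
    using factor_eqns_of_closure[OF closure u] .
  have "\<exists>X L. flag X L \<and> img_factor Pt A X L u1 \<and> img_factor Pt C X L u3 \<and> img_factor Line B X L u2"
    using avoid eqns by (intro flag_PPL[OF assms(1,3,2,4) u(1,3,2) X]) (simp_all add: avoids_epipoles_def)
  then show ?thesis by (auto simp: consistent_def)
qed

lemma consistent_PPP:
  assumes "camera A" "camera B" "camera C" "center A \<noteq> center B" "center A \<noteq> center C"
    and u: "u1 \<noteq> 0" "u2 \<noteq> 0" "u3 \<noteq> 0"
    and avoid: "avoids_epipoles (Pt, Pt, Pt) A B C (u1, u2, u3)"
    and closure: "(u1, u2, u3) \<in> zariski_closure (mv_image (Pt, Pt, Pt) A B C)"
  shows "consistent (Pt, Pt, Pt) A B C (u1, u2, u3)"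
proof -
  obtain X m1 m2 m3 where "X \<noteq> 0"
    "factor_eqn Pt A u1 X m1" "factor_eqn Pt B u2 X m2" "factor_eqn Pt C u3 X m3"
    using factor_eqns_of_closure[OF closure u] .
  then show ?thesis
    using flag_PPP[OF assms(1-5) u] avoid by (simp add: consistent_def avoids_epipoles_def)
qed

lemma consistent_LLL:
  assumes u: "u1 \<noteq> 0" "u2 \<noteq> 0" "u3 \<noteq> 0"
    and avoid: "avoids_epipoles (Line, Line, Line) A B C (u1, u2, u3)"
    and closure: "(u1, u2, u3) \<in> zariski_closure (mv_image (Line, Line, Line) A B C)"
  shows "consistent (Line, Line, Line) A B C (u1, u2, u3)"
proof -
  obtain c1 c2 c3 where c: "c1 \<noteq> 0 \<or> c2 \<noteq> 0 \<or> c3 \<noteq> 0"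
    and dependent: "\<And>x. c1 * bdot u1 (A *v x) + c2 * bdot u2 (B *v x) + c3 * bdot u3 (C *v x) = 0"
    using backproj_dependent_of_closure[OF closure] by blast
  have av: "avoids_epipole Line A B u1" "avoids_epipole Line A C u1" "avoids_epipole Line B A u2"
    "avoids_epipole Line B C u2" "avoids_epipole Line C A u3" "avoids_epipole Line C B u3"
    using avoid by (simp_all add: avoids_epipoles_def)
  from c consider "c3 \<noteq> 0" | "c1 \<noteq> 0" | "c2 \<noteq> 0" by blast
  then show ?thesis
  proof cases
    case 1
    show ?thesis using flag_LLL[OF u 1 dependent av(3,1,2)] by (simp add: consistent_def)
  next
    case 2
    have "c2 * bdot u2 (B *v x) + c3 * bdot u3 (C *v x) + c1 * bdot u1 (A *v x) = 0" for x
      using dependent[of x] by (simp add: algebra_simps)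
    from flag_LLL[OF u(2,3,1) 2 this av(6,4,3)] show ?thesis by (auto simp: consistent_def)
  next
    case 3
    have "c1 * bdot u1 (A *v x) + c3 * bdot u3 (C *v x) + c2 * bdot u2 (B *v x) = 0" for x
      using dependent[of x] by (simp add: algebra_simps)
    from flag_LLL[OF u(1,3,2) 3 this av(5,2,1)] show ?thesis by (auto simp: consistent_def)
  qed
qed

theorem lemma3p5:
  fixes A B C :: "complex^4^3"
    and t :: "kind \<times> kind \<times> kind"
    and p :: "(complex^3) \<times> (complex^3) \<times> (complex^3)"
  assumes "camera A" and "camera B" and "camera C"
    and "center A \<noteq> center B" and "center A \<noteq> center C" and "center B \<noteq> center C"
    and "t \<in> {(Pt, Line, Line), (Line, Line, Line), (Pt, Pt, Line), (Pt, Line, Pt), (Pt, Pt, Pt)}"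
    and "fst p \<noteq> 0" and "fst (snd p) \<noteq> 0" and "snd (snd p) \<noteq> 0"
    and "avoids_epipoles t A B C p"
    and "p \<in> multiview_variety t A B C"
  shows "consistent t A B C p"
proof -
  obtain u1 u2 u3 where p: "p = (u1, u2, u3)" by (cases p)
  have u: "u1 \<noteq> 0" "u2 \<noteq> 0" "u3 \<noteq> 0" using assms(8-10) by (simp_all add: p)
  have "p \<in> zariski_closure (mv_image t A B C)"
    using assms(12) by (simp add: multiview_variety_def)
  then show ?thesis
    using assms(7,11) consistent_PLL[OF u] consistent_LLL[OF u] consistent_PPL[OF assms(1-4) u]
      consistent_PLP[OF assms(1-3,5) u] consistent_PPP[OF assms(1-5) u]
    unfolding p by auto
qed

end
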